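(* Let $X$ be a reflexive real Banach space with dual $X^*$. (1) If $L : X\times X^*\to \mathbb{R}\cup\{+\infty\}$ is a proper selfdual Lagrangian, then the set-valued vector field $x\mapsto \overline{\partial} L(x)$ from $X$ to $2^{X^*}$ is maximal monotone. (2) Conversely, if $T : D(T)\subset X\to 2^{X^*}$ is a maximal monotone operator with non-empty domain, then there exists a selfdual Lagrangian $N : X\times X^*\to\mathbb{R}\cup\{+\infty\}$ such that $T=\overline{\partial} N$.
   Context: For a function $L : X\times X^*\to\mathbb{R}\cup\{+\infty\}$, its Legendre transform in both variables is, for $(p,x)\in X^*\times X$, $$L^*(p,x)=\sup\{\langle p,y\rangle+\langle x,q\rangle-L(y,q) : (y,q)\in X\times X^*\}.$$ A selfdual Lagrangian on $X\times X^*$ is a function $L : X\times X^*\to\mathbb{R}\cup\{+\infty\}$ that is convex and lower semicontinuous (jointly in both variables) and satisfies $L^*(p,x)=L(x,p)$ for all $(p,x)\in X^*\times X$. It is proper if it is not identically $+\infty$. The derived vector field of $L$ is the set-valued map defined for $x\in X$ by $$\overline{\partial} L(x)=\{p\in X^* : L(x,p)-\langle x,p\rangle=0\}$$ (possibly empty). A set-valued map $T : X\to 2^{X^*}$ has graph $G(T)=\{(x,p)\in X\times X^* : p\in T(x)\}$ and domain $D(T)=\{x\in X : T(x)\neq\emptyset\}$. It is monotone if $\langle x-y,p-q\rangle\ge 0$ for all $(x,p),(y,q)\in G(T)$, and maximal monotone if $G(T)$ is maximal, with respect to inclusion, among the monotone subsets of $X\times X^*$. The equality $T=\overline{\partial}N$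 means that $T(x)=\overline{\partial}N(x)$ for all $x\in X$, where $T(x)=\emptyset$ for $x\notin D(T)$. *)

theory Defs
  imports "HOL-Analysis.Analysis"
begin

text \<open>
  The dual \<open>X\<^sup>*\<close> of \<open>X = 'a\<close> is the normed space of bounded linear functionals, and the
  duality pairing \<open>\<langle>x, p\<rangle>\<close> is application \<open>blinfun_apply p x\<close>.
\<close>

type_synonym 'a dual = "'a \<Rightarrow>\<^sub>L real"

definition bidual_embedding :: "'a::real_normed_vector \<Rightarrow> 'a dual dual" where
  "bidual_embedding x = Blinfun (\<lambda>p. blinfun_apply p x)"

lemma bidual_embedding_apply [simp]: "blinfun_apply (bidual_embedding x) p = blinfun_apply p x"
  unfolding bidual_embedding_def
  by (simp add: bounded_linear_Blinfun_apply blinfun.bounded_linear_left)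

definition reflexive_space :: "'a::real_normed_vector itself \<Rightarrow> bool" where
  "reflexive_space _ \<longleftrightarrow> surj (bidual_embedding :: 'a \<Rightarrow> 'a dual dual)"

text \<open>
  For functions that avoid \<open>- \<infinity>\<close> the right-hand side below involves no indeterminate sum;
  at the endpoints it relies on \<open>0 * \<infinity> = 0\<close> in \<^typ>\<open>ereal\<close>.
\<close>

definition convex_fun :: "('b::real_vector \<Rightarrow> ereal) \<Rightarrow> bool" where
  "convex_fun f \<longleftrightarrow> (\<forall>z w. \<forall>u\<ge>0. \<forall>v\<ge>0. u + v = 1 \<longrightarrow>
     f (u *\<^sub>R z + v *\<^sub>R w) \<le> ereal u * f z + ereal v * f w)"

definition lower_semicontinuous :: "('b::topological_space \<Rightarrow> ereal) \<Rightarrow> bool" where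
  "lower_semicontinuous f \<longleftrightarrow> (\<forall>z. f z \<le> Liminf (at z) f)"

definition legendre ::
  "('a::real_normed_vector \<times> 'a dual \<Rightarrow> ereal) \<Rightarrow> 'a dual \<times> 'a \<Rightarrow> ereal" where
  "legendre L = (\<lambda>(p, x). SUP (y, q) \<in> UNIV. ereal (blinfun_apply p y + blinfun_apply q x) - L (y, q))"

definition selfdual_lagrangian :: "('a::real_normed_vector \<times> 'a dual \<Rightarrow> ereal) \<Rightarrow> bool" where
  "selfdual_lagrangian L \<longleftrightarrow>
     (\<forall>z. L z \<noteq> - \<infinity>) \<and> convex_fun L \<and> lower_semicontinuous L \<and>
     (\<forall>p x. legendre L (p, x) = L (x, p))"

definition proper_fun :: "('b \<Rightarrow> ereal) \<Rightarrow> bool" where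
  "proper_fun f \<longleftrightarrow> (\<exists>z. f z \<noteq> \<infinity>)"

definition derived_field ::
  "('a::real_normed_vector \<times> 'a dual \<Rightarrow> ereal) \<Rightarrow> 'a \<Rightarrow> 'a dual set" where
  "derived_field L x = {p. L (x, p) - ereal (blinfun_apply p x) = 0}"

definition op_graph :: "('a::real_normed_vector \<Rightarrow> 'a dual set) \<Rightarrow> ('a \<times> 'a dual) set" where
  "op_graph T = {(x, p). p \<in> T x}"

definition op_domain :: "('a::real_normed_vector \<Rightarrow> 'a dual set) \<Rightarrow> 'a set" where
  "op_domain T = {x. T x \<noteq> {}}"

definition monotone_set :: "('a::real_normed_vector \<times> 'a dual) set \<Rightarrow> bool" where
  "monotone_set M \<longleftrightarrow> (\<forall>(x, p) \<in> M. \<forall>(y, q) \<in> M. 0 \<le> blinfun_apply (p - q) (x - y))"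

definition maximal_monotone :: "('a::real_normed_vector \<Rightarrow> 'a dual set) \<Rightarrow> bool" where
  "maximal_monotone T \<longleftrightarrow> monotone_set (op_graph T) \<and>
     (\<forall>M. monotone_set M \<and> op_graph T \<subseteq> M \<longrightarrow> M = op_graph T)"

end

theory Submission
  imports Defs
begin

text \<open>
  A Lagrangian is selfdual iff its epigraph \<open>P\<close> equals its polar with respect to the symmetric
  pairing \<open>B((x, p), (y, q)) = \<langle>y, p\<rangle> + \<langle>x, q\<rangle>\<close>, and its derived field consists of the points \<open>z\<close>
  with \<open>(z, B(z, z) / 2) \<in> P\<close>. Everything rests on Fenchel duality with the quadratic function
  \<open>\<parallel>z\<parallel>\<^sup>2 / 2\<close>, which is its own conjugate: by Hahn-Banach the dual infimum is attained, and
  reflexivity places the minimizer in the phase space itself, so no weak compactness is needed.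

  For maximality, let \<open>z\<^sub>0\<close> be monotonically related to the graph. Duality applied to \<open>L\<close>
  recentred at \<open>z\<^sub>0\<close> gives \<open>v\<close> with \<open>z\<^sub>0 - v\<close> in the graph and \<open>B(v, v) + \<parallel>v\<parallel>\<^sup>2 = 0\<close>; monotonicity
  gives \<open>B(v, v) \<ge> 0\<close>, hence \<open>v = 0\<close>. For the converse, duality shows that the proximal average
  \<open>N(z) = inf\<^sub>u (F(z + u) / 2 + F\<^sup>*(z - u) / 2 + \<parallel>u\<parallel>\<^sup>2 / 2)\<close> of the Fitzpatrick function \<open>F\<close> of \<open>T\<close>
  and its conjugate is selfdual. Its derived field contains the graph of \<open>T\<close>, so maximality of
  \<open>T\<close> forces equality.
\<close>

section \<open>Sublinear functionals and the Hahn-Banach theorem\<close>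

definition sublinear :: "('v::real_vector \<Rightarrow> real) \<Rightarrow> bool" where
  "sublinear S \<longleftrightarrow> (\<forall>x y. S (x + y) \<le> S x + S y) \<and> (\<forall>t>0. \<forall>x. S (t *\<^sub>R x) = t * S x)"

lemma sublinear_add: "sublinear S \<Longrightarrow> S (x + y) \<le> S x + S y"
  and sublinear_scale: "sublinear S \<Longrightarrow> t > 0 \<Longrightarrow> S (t *\<^sub>R x) = t * S x"
  by (auto simp: sublinear_def)

lemma sublinear_zero:
  assumes "sublinear S"
  shows "S 0 = 0"
  using sublinear_scale[OF assms, of 2 0] by simp

lemma sublinear_scale_nonneg:
  assumes "sublinear S" "t \<ge> 0"
  shows "S (t *\<^sub>R x) = t * S x"
  using assms sublinear_scale[OF assms(1), of t x] sublinear_zero[OF assms(1)]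
  by (cases "t = 0") auto

text \<open>The common construction behind the Hahn-Banach steps: \<open>R x\<close> holds candidate
  values, and sublinearity passes to their infimum. It is finite because adding a fixed candidate at
  \<open>- x\<close> to any candidate at \<open>x\<close> dominates a candidate at 0, which is
  nonnegative.\<close>

lemma sublinear_Inf:
  fixes R :: "'v::real_vector \<Rightarrow> real set"
  assumes nonempty: "\<And>x. R x \<noteq> {}"
    and add: "\<And>x y r s. r \<in> R x \<Longrightarrow> s \<in> R y \<Longrightarrow> \<exists>q\<in>R (x + y). q \<le> r + s"
    and scale: "\<And>x r t. r \<in> R x \<Longrightarrow> t > 0 \<Longrightarrow> t * r \<in> R (t *\<^sub>R x)"
    and zero: "\<And>r. r \<in> R 0 \<Longrightarrow> 0 \<le> r"
  shows "sublinear (\<lambda>x. Inf (R x))" and "r \<in> R x \<Longrightarrow> Inf (R x) \<le> r"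
proof -
  have bdd: "bdd_below (R x)" for x
  proof -
    obtain s where s: "s \<in> R (- x)" using nonempty by blast
    have "- s \<le> r" if "r \<in> R x" for r
      using add[OF that s] zero by fastforce
    then show ?thesis by (meson bdd_below.I)
  qed
  have lower: "Inf (R x) \<le> r" if "r \<in> R x" for x r
    using that bdd by (rule cInf_lower)
  then show "r \<in> R x \<Longrightarrow> Inf (R x) \<le> r" .
  have "Inf (R (x + y)) \<le> Inf (R x) + Inf (R y)" for x y
  proof -
    have "Inf (R (x + y)) - r \<le> Inf (R y)" if r: "r \<in> R x" for r
    proof (rule cInf_greatest[OF nonempty])
      fix s assume "s \<in> R y"
      from add[OF r this] lower show "Inf (R (x + y)) - r \<le> s"
        by (smt (verit))
    qed
    then have "Inf (R (x + y)) - Inf (R y) \<le> Inf (R x)"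
      by (intro cInf_greatest[OF nonempty]) (smt (verit))
    then show ?thesis by simp
  qed
  moreover have le: "Inf (R (t *\<^sub>R x)) \<le> t * Inf (R x)" if t: "t > 0" for t x
  proof -
    have "Inf (R (t *\<^sub>R x)) / t \<le> Inf (R x)"
      using lower[OF scale[OF _ t]] t
      by (intro cInf_greatest[OF nonempty]) (simp add: field_simps)
    then show ?thesis using t by (simp add: field_simps)
  qed
  moreover have "t * Inf (R x) \<le> Inf (R (t *\<^sub>R x))" if t: "t > 0" for t x
    using le[of "inverse t" "t *\<^sub>R x"] t by (simp add: field_simps)
  ultimately show "sublinear (\<lambda>x. Inf (R x))"
    unfolding sublinear_def by (meson order_antisym)
qed

text \<open>For fixed y, the infimum over t \<ge> 0 of T (x + t y) - t T y is sublinear and lies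
  below T (take t = 0), so it equals T by minimality. The choice t = 1 then gives
  superadditivity.\<close>

lemma minimal_sublinear_is_linear:
  fixes T :: "'v::real_vector \<Rightarrow> real"
  assumes T: "sublinear T"
    and minimal: "\<And>U. sublinear U \<Longrightarrow> (\<And>x. U x \<le> T x) \<Longrightarrow> U = T"
  shows "linear T"
proof -
  have super: "T x + T y \<le> T (x + y)" for x y
  proof -
    define R where "R x = {T (x + t *\<^sub>R y) - t * T y |t. t \<ge> 0}" for x
    have R: "R x \<noteq> {}" for x
      unfolding R_def by auto
    have R_add: "\<exists>q\<in>R (x + x'). q \<le> r + s" if "r \<in> R x" "s \<in> R x'" for x x' r s
    proof -
      obtain t t' where t: "t \<ge> 0" "r = T (x + t *\<^sub>R y) - t * T y"
        "t' \<ge> 0" "s = T (x' + t' *\<^sub>R y) - t' * T y"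
        using \<open>r \<in> R x\<close> \<open>s \<in> R x'\<close> unfolding R_def by auto
      have "x + x' + (t + t') *\<^sub>R y = (x + t *\<^sub>R y) + (x' + t' *\<^sub>R y)"
        by (simp add: algebra_simps)
      then have "T (x + x' + (t + t') *\<^sub>R y) - (t + t') * T y \<le> r + s"
        using sublinear_add[OF T, of "x + t *\<^sub>R y" "x' + t' *\<^sub>R y"] t
        by (simp add: algebra_simps)
      moreover have "T (x + x' + (t + t') *\<^sub>R y) - (t + t') * T y \<in> R (x + x')"
        unfolding R_def using t(1,3) by (intro CollectI exI[of _ "t + t'"]) simp
      ultimately show ?thesis by blast
    qed
    have R_scale: "k * r \<in> R (k *\<^sub>R x)" if r: "r \<in> R x" and k: "k > 0" for x r k
    proof -
      obtain t where t: "t \<ge> 0" "r = T (x + t *\<^sub>R y) - t * T y"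
        using r unfolding R_def by auto
      have "k * r = T (k *\<^sub>R x + (k * t) *\<^sub>R y) - (k * t) * T y"
        using sublinear_scale[OF T k, of "x + t *\<^sub>R y"] unfolding t(2)
        by (simp add: algebra_simps)
      then show ?thesis unfolding R_def using t k by (intro CollectI exI[of _ "k * t"]) simp
    qed
    have R_zero: "0 \<le> r" if "r \<in> R 0" for r
      using that sublinear_scale_nonneg[OF T] unfolding R_def by auto
    have R_Inf: "sublinear (\<lambda>x. Inf (R x))" "\<And>x r. r \<in> R x \<Longrightarrow> Inf (R x) \<le> r"
    by (rule sublinear_Inf[of R, OF R R_add R_scale R_zero]; assumption)+
    have "T x \<in> R x" for x
      unfolding R_def by (intro CollectI exI[of _ 0]) simp
    then have "(\<lambda>x. Inf (R x)) = T"
      using R_Inf by (intro minimal) auto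
    moreover have "T (x + y) - T y \<in> R x"
      unfolding R_def by (intro CollectI exI[of _ 1]) simp
    then have "Inf (R x) \<le> T (x + y) - T y"
      using R_Inf(2) by blast
    ultimately show ?thesis by (metis le_diff_eq)
  qed
  have add: "T (x + y) = T x + T y" for x y
    using super[of x y] sublinear_add[OF T, of x y] by simp
  have minus: "T (- x) = - T x" for x
    using add[of x "- x"] sublinear_zero[OF T] by simp
  have "T (t *\<^sub>R x) = t * T x" for t x
    using sublinear_scale_nonneg[OF T, of t x] sublinear_scale_nonneg[OF T, of "- t" x]
      minus[of "t *\<^sub>R x"] by (cases "t \<ge> 0") auto
  then show ?thesis using add by (intro linearI) auto
qed

text \<open>Zorn's lemma for the reversed pointwise order: a chain of sublinear functionals below
  \<open>S\<close> is bounded below by its pointwise infimum, and a minimal element is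
  linear.\<close>

lemma sublinear_linear_minorant:
  fixes S :: "'v::real_vector \<Rightarrow> real"
  assumes S: "sublinear S"
  obtains l where "linear l" "\<And>x. l x \<le> S x"
proof -
  define A where "A = {T. sublinear T \<and> T \<le> S}"
  have "partial_order_on A (relation_of (\<lambda>T U. U \<le> T) A)"
    by (auto simp: partial_order_on_def preorder_on_def relation_of_def refl_on_def trans_def
        antisym_def)
  moreover have "\<exists>U\<in>A. \<forall>T\<in>C. U \<le> T" if C: "C \<in> Chains (relation_of (\<lambda>T U. U \<le> T) A)" for C
  proof (cases "C = {}")
    case True
    then show ?thesis using S by (auto simp: A_def)
  next
    case False
    have CA: "C \<subseteq> A" using C by (auto simp: Chains_def relation_of_def)
    have sub: "sublinear T" if "T \<in> C" for T using CA that by (auto simp: A_def)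
    have total: "T \<le> U \<or> U \<le> T" if "T \<in> C" "U \<in> C" for T U
      using C that by (auto simp: Chains_def relation_of_def)
    define R where "R x = (\<lambda>T. T x) ` C" for x
    have R: "R x \<noteq> {}" for x
      unfolding R_def using False by simp
    have R_add: "\<exists>q\<in>R (x + y). q \<le> r + s" if "r \<in> R x" "s \<in> R y" for x y r s
    proof -
      obtain T U where TU: "T \<in> C" "r = T x" "U \<in> C" "s = U y"
        using \<open>r \<in> R x\<close> \<open>s \<in> R y\<close> unfolding R_def by auto
      \<comment> \<open>Totality of the chain lets a single functional serve for both
        candidates.\<close>
      obtain W where "W \<in> C" "W \<le> T" "W \<le> U"
        using total TU by blast
      then have "W (x + y) \<le> r + s"
        using TU sublinear_add[OF sub[OF \<open>W \<in> C\<close>], of x y] by (smt (verit) le_funD)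
      then show ?thesis using \<open>W \<in> C\<close> unfolding R_def by auto
    qed
    have R_scale: "t * r \<in> R (t *\<^sub>R x)" if "r \<in> R x" "t > 0" for x r t
      using that sublinear_scale[OF sub] unfolding R_def by force
    have R_zero: "0 \<le> r" if "r \<in> R 0" for r
      using that unfolding R_def by (metis imageE order_refl sub sublinear_zero)
    have R_Inf: "sublinear (\<lambda>x. Inf (R x))" "\<And>x r. r \<in> R x \<Longrightarrow> Inf (R x) \<le> r"
    by (rule sublinear_Inf[of R, OF R R_add R_scale R_zero]; assumption)+
    have le: "Inf (R x) \<le> T x" if "T \<in> C" for x T
      using R_Inf(2) that unfolding R_def by auto
    obtain T where "T \<in> C" "T \<le> S"
      using False CA by (auto simp: A_def)
    then have "(\<lambda>x. Inf (R x)) \<in> A"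
      unfolding A_def using R_Inf(1) le order_trans by (fastforce simp: le_fun_def)
    then show ?thesis
      using le by (intro bexI[of _ "\<lambda>x. Inf (R x)"]) (auto simp: le_fun_def)
  qed
  ultimately obtain T where T: "T \<in> A" "\<And>U. U \<in> A \<Longrightarrow> U \<le> T \<Longrightarrow> U = T"
    using predicate_Zorn[of A "\<lambda>T U. U \<le> T"] by blast
  have "linear T"
  proof (rule minimal_sublinear_is_linear)
    show "sublinear T" using T(1) by (simp add: A_def)
    show "U = T" if "sublinear U" "\<And>x. U x \<le> T x" for U
      using that T order_trans[of U T S] by (auto simp: A_def le_fun_def)
  qed
  with T(1) that show thesis by (auto simp: A_def le_fun_def)
qed

section \<open>Fenchel duality with a quadratic function\<close>

text \<open>
  Elements \<open>(y, r)\<close> of \<open>C\<close> play the role of points of an epigraph, possibly pushed forward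
  along a linear map, so that no properness or domain conditions arise.
\<close>

lemma sandwich:
  fixes g :: "'v::real_vector \<Rightarrow> real" and C :: "('v \<times> real) set"
  assumes g: "convex_on UNIV g" and C: "convex C" "C \<noteq> {}"
    and nonneg: "\<And>y r. (y, r) \<in> C \<Longrightarrow> 0 \<le> g y + r"
  obtains l where "linear l" "\<And>y r z. (y, r) \<in> C \<Longrightarrow> l z - g z \<le> l y + r"
proof -
  \<comment> \<open>The infimum of \<open>R x\<close> is the positively homogeneous hull of x
    \<mapsto> inf (g (y + x) + r). A linear minorant of it, read at \<open>z - y\<close> with a = 1,
    is the required \<open>l\<close>.\<close>
  define R where "R x = {a * (g (y + x /\<^sub>R a) + r) |a y r. a > 0 \<and> (y, r) \<in> C}" for x
  have R: "R x \<noteq> {}" for x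
  proof -
    obtain y r where "(y, r) \<in> C" using C(2) by auto
    then have "1 * (g (y + x /\<^sub>R 1) + r) \<in> R x"
      unfolding R_def by (intro CollectI exI[of _ 1] exI[of _ y] exI[of _ r]) simp
    then show ?thesis by blast
  qed
  have R_add: "\<exists>q\<in>R (x + x'). q \<le> e + e'" if "e \<in> R x" "e' \<in> R x'" for x x' e e'
  proof -
    obtain a y r b z s where *: "a > 0" "(y, r) \<in> C" "e = a * (g (y + x /\<^sub>R a) + r)"
      "b > 0" "(z, s) \<in> C" "e' = b * (g (z + x' /\<^sub>R b) + s)"
      using \<open>e \<in> R x\<close> \<open>e' \<in> R x'\<close> unfolding R_def by blast
    \<comment> \<open>Weights proportional to the two scaling factors let convexity of
      \<open>g\<close> and \<open>C\<close> merge both candidates into one with factor a +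
      b.\<close>
    define c where "c = a + b"
    define u v where "u = a / c" and "v = b / c"
    have c: "c > 0" and uv: "u \<ge> 0" "v \<ge> 0" "u + v = 1" "c * u = a" "c * v = b"
      using * by (auto simp: c_def u_def v_def add_divide_distrib[symmetric])
    have mem: "(u *\<^sub>R y + v *\<^sub>R z, u * r + v * s) \<in> C"
      using convexD[OF C(1) *(2,5) uv(1-3)] by simp
    have ab: "u /\<^sub>R a = 1 /\<^sub>R c" "v /\<^sub>R b = 1 /\<^sub>R c"
      using * c by (auto simp: u_def v_def field_simps)
    have "u *\<^sub>R y + v *\<^sub>R z + (x + x') /\<^sub>R c = u *\<^sub>R (y + x /\<^sub>R a) + v *\<^sub>R (z + x' /\<^sub>R b)"
      using ab by (simp add: algebra_simps)
    then have "g (u *\<^sub>R y + v *\<^sub>R z + (x + x') /\<^sub>R c) \<le> u * g (y + x /\<^sub>R a) + v * g (z + x' /\<^sub>R b)"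
      using g uv(1-3) unfolding convex_on_def by simp
    then have "c * (g (u *\<^sub>R y + v *\<^sub>R z + (x + x') /\<^sub>R c) + (u * r + v * s))
      \<le> c * (u * g (y + x /\<^sub>R a) + v * g (z + x' /\<^sub>R b) + (u * r + v * s))"
      using c by simp
    also have "\<dots> = (c * u) * (g (y + x /\<^sub>R a) + r) + (c * v) * (g (z + x' /\<^sub>R b) + s)"
      by (simp add: algebra_simps)
    also have "\<dots> = e + e'"
      using * uv by simp
    finally show ?thesis
      using mem c unfolding R_def by blast
  qed
  have R_scale: "t * e \<in> R (t *\<^sub>R x)" if "e \<in> R x" and t: "t > 0" for x e t
  proof -
    obtain a y r where *: "a > 0" "(y, r) \<in> C" "e = a * (g (y + x /\<^sub>R a) + r)"
      using \<open>e \<in> R x\<close> unfolding R_def by blast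
    have "t * e = (t * a) * (g (y + (t *\<^sub>R x) /\<^sub>R (t * a)) + r)"
      using * t by (simp add: field_simps)
    moreover have "t * a > 0" using * t by simp
    ultimately show ?thesis using * unfolding R_def by blast
  qed
  have R_zero: "0 \<le> e" if "e \<in> R 0" for e
    using that nonneg unfolding R_def by auto
  have R_Inf: "sublinear (\<lambda>x. Inf (R x))" "\<And>x r. r \<in> R x \<Longrightarrow> Inf (R x) \<le> r"
    by (rule sublinear_Inf[of R, OF R R_add R_scale R_zero]; assumption)+
  obtain l where l: "linear l" "\<And>x. l x \<le> Inf (R x)"
    using sublinear_linear_minorant[OF R_Inf(1)] by blast
  have "l z - g z \<le> l y + r" if "(y, r) \<in> C" for y r z
  proof -
    have "1 * (g (y + (z - y) /\<^sub>R 1) + r) \<in> R (z - y)"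
      unfolding R_def using that
      by (intro CollectI exI[of _ 1] exI[of _ y] exI[of _ r]) simp
    from R_Inf(2)[OF this] l(2)[of "z - y"] show ?thesis
      by (simp add: linear_diff[OF l(1)])
  qed
  with l(1) that show thesis by blast
qed

text \<open>Half the squared dual norm is the conjugate of half the squared norm: on the line
  through z, the scalar l z / n with n = norm z squared maximizes the tested expression. Boundedness
  of \<open>l\<close> comes out of the same estimate.\<close>

lemma norm_le_of_quadratic_bound:
  fixes l :: "'v::real_normed_vector \<Rightarrow> real"
  assumes l: "linear l" and bound: "\<And>z. l z - (norm z)\<^sup>2 / 2 \<le> c"
  shows "bounded_linear l" and "(norm (Blinfun l))\<^sup>2 / 2 \<le> c"
proof -
  have c: "c \<ge> 0"
    using bound[of 0] by (simp add: linear_0[OF l])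
  have le: "\<bar>l z\<bar> \<le> sqrt (2 * c) * norm z" for z
  proof (cases "z = 0")
    case True
    then show ?thesis by (simp add: linear_0[OF l])
  next
    case False
    define n where "n = (norm z)\<^sup>2"
    have n: "n > 0" using False by (simp add: n_def)
    have "l ((l z / n) *\<^sub>R z) - (norm ((l z / n) *\<^sub>R z))\<^sup>2 / 2 \<le> c"
      by (rule bound)
    then have "l z / n * l z - (l z / n)\<^sup>2 * n / 2 \<le> c"
      by (simp add: linear_scale[OF l] power_mult_distrib n_def power_divide)
    moreover have "l z / n * l z - (l z / n)\<^sup>2 * n / 2 = (l z)\<^sup>2 / n / 2"
      using n by (simp add: field_simps power2_eq_square)
    ultimately have "(l z)\<^sup>2 / n / 2 \<le> c"
      by simp
    then have "(l z)\<^sup>2 \<le> 2 * c * n"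
      using n by (simp add: field_simps)
    then have "sqrt ((l z)\<^sup>2) \<le> sqrt (2 * c * n)"
      by (rule real_sqrt_le_mono)
    then show ?thesis
      by (simp add: n_def real_sqrt_mult)
  qed
  show bl: "bounded_linear l"
    by (rule bounded_linear_intro[where K = "sqrt (2 * c)"])
      (use le in \<open>auto simp: linear_add[OF l] linear_scale[OF l] mult.commute\<close>)
  have "norm (Blinfun l) \<le> sqrt (2 * c)"
    using le c by (intro norm_blinfun_bound) (auto simp: bounded_linear_Blinfun_apply[OF bl])
  then have "(norm (Blinfun l))\<^sup>2 \<le> (sqrt (2 * c))\<^sup>2"
    by (rule power_mono) simp
  then show "(norm (Blinfun l))\<^sup>2 / 2 \<le> c"
    using c by simp
qed

lemma convex_on_norm_power2:
  "convex_on UNIV (\<lambda>z::'v::real_normed_vector. (norm z)\<^sup>2 / 2)"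
proof (rule convex_onI)
  fix t :: real and x y :: 'v
  assume t: "0 < t" "t < 1"
  have "norm ((1 - t) *\<^sub>R x + t *\<^sub>R y) \<le> (1 - t) * norm x + t * norm y"
    using norm_triangle_ineq[of "(1 - t) *\<^sub>R x" "t *\<^sub>R y"] t by simp
  then have "(norm ((1 - t) *\<^sub>R x + t *\<^sub>R y))\<^sup>2 \<le> ((1 - t) * norm x + t * norm y)\<^sup>2"
    by (rule power_mono) simp
  also have "\<dots> = (1 - t) * (norm x)\<^sup>2 + t * (norm y)\<^sup>2 - (1 - t) * t * (norm x - norm y)\<^sup>2"
    by (simp add: power2_eq_square algebra_simps)
  also have "\<dots> \<le> (1 - t) * (norm x)\<^sup>2 + t * (norm y)\<^sup>2"
    using t by simp
  finally show "(norm ((1 - t) *\<^sub>R x + t *\<^sub>R y))\<^sup>2 / 2 \<le> (1 - t) * ((norm x)\<^sup>2 / 2) + t * ((norm y)\<^sup>2 / 2)"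
    by simp
qed simp

lemma quadratic_duality:
  fixes C :: "('v::real_normed_vector \<times> real) set"
  assumes C: "convex C" "C \<noteq> {}" and nonneg: "\<And>y r. (y, r) \<in> C \<Longrightarrow> 0 \<le> (norm y)\<^sup>2 / 2 + r"
  obtains f :: "'v dual" where "\<And>y r. (y, r) \<in> C \<Longrightarrow> (norm f)\<^sup>2 / 2 \<le> f y + r"
proof -
  obtain l where l: "linear l" "\<And>y r z. (y, r) \<in> C \<Longrightarrow> l z - (norm z)\<^sup>2 / 2 \<le> l y + r"
    using sandwich[OF convex_on_norm_power2 C nonneg] by blast
  show thesis
  proof (rule that)
    fix y r assume "(y, r) \<in> C"
    with norm_le_of_quadratic_bound[OF l(1) l(2)]
    show "(norm (Blinfun l))\<^sup>2 / 2 \<le> Blinfun l y + r"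
      by (simp add: bounded_linear_Blinfun_apply)
  qed
qed

text \<open>Duality for a one-point set. By Young's inequality the conclusion forces equality, so
  \<open>q\<close> has the norm of \<open>x\<close> and attains the square of that norm at
  \<open>x\<close>.\<close>

lemma dual_norming:
  fixes x :: "'v::real_normed_vector"
  obtains q :: "'v dual" where "(norm q)\<^sup>2 / 2 + (norm x)\<^sup>2 / 2 \<le> q x"
proof -
  obtain q :: "'v dual" where
    "\<And>y r. (y, r) \<in> {(x, - ((norm x)\<^sup>2 / 2))} \<Longrightarrow> (norm q)\<^sup>2 / 2 \<le> q y + r"
    by (rule quadratic_duality[of "{(x, - ((norm x)\<^sup>2 / 2))}"]) auto
  then show thesis using that[of q] by simp
qed

section \<open>The symmetric pairing on the phase space\<close>

text \<open>The swap of (p, x) and (x, p) is built in, so the Legendre transform becomes a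
  conjugation on the phase space itself.\<close>

definition pairing :: "'a::real_normed_vector \<times> 'a dual \<Rightarrow> 'a \<times> 'a dual \<Rightarrow> real" where
  "pairing z w = blinfun_apply (snd z) (fst w) + blinfun_apply (snd w) (fst z)"

definition coupling :: "'a::real_normed_vector \<times> 'a dual \<Rightarrow> real" where
  "coupling z = blinfun_apply (snd z) (fst z)"

lemma pairing_commute: "pairing z w = pairing w z"
  by (simp add: pairing_def)

lemma pairing_self: "pairing z z = 2 * coupling z"
  by (simp add: pairing_def coupling_def)

lemma norm_prod_power2: "(norm z)\<^sup>2 = (norm (fst z))\<^sup>2 + (norm (snd z))\<^sup>2"
  by (cases z) (simp add: norm_Pair)

text \<open>Cauchy-Schwarz in the plane, as the product norm is Euclidean. The constant 1 is
  essential: it lets the quadratic function dominate the pairing exactly.\<close>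

lemma abs_pairing_le: "\<bar>pairing z w\<bar> \<le> norm z * norm w"
proof -
  have "\<bar>pairing z w\<bar> \<le> norm (snd z) * norm (fst w) + norm (snd w) * norm (fst z)"
    unfolding pairing_def using norm_blinfun[of "snd z" "fst w"] norm_blinfun[of "snd w" "fst z"]
    by simp
  also have "\<dots> \<le> norm z * norm w"
  proof (rule power2_le_imp_le)
    have "0 \<le> (norm (fst z) * norm (fst w) - norm (snd z) * norm (snd w))\<^sup>2"
      by (rule zero_le_power2)
    then show "(norm (snd z) * norm (fst w) + norm (snd w) * norm (fst z))\<^sup>2 \<le> (norm z * norm w)\<^sup>2"
      unfolding power_mult_distrib norm_prod_power2 by (simp add: power2_eq_square algebra_simps)
  qed simp
  finally show ?thesis .
qed

lemma abs_pairing_le_squares: "\<bar>pairing z w\<bar> \<le> (norm z)\<^sup>2 / 2 + (norm w)\<^sup>2 / 2"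
proof -
  have "0 \<le> (norm z - norm w)\<^sup>2" by simp
  then show ?thesis
    using abs_pairing_le[of z w] by (simp add: power2_eq_square algebra_simps)
qed

lemma bounded_bilinear_pairing: "bounded_bilinear pairing"
proof
  show "\<exists>K. \<forall>a b. norm (pairing a b) \<le> norm a * norm b * K"
    by (intro exI[of _ 1] allI) (simp only: real_norm_def mult_1_right abs_pairing_le)
qed (simp_all add: pairing_def blinfun.add_left blinfun.add_right blinfun.scaleR_left
    blinfun.scaleR_right algebra_simps)

interpretation pairing: bounded_bilinear pairing
  by (rule bounded_bilinear_pairing)

lemmas pairing_simps = pairing.add_left pairing.add_right pairing.diff_left pairing.diff_right
  pairing.scaleR_left pairing.scaleR_right

lemma coupling_diff: "coupling (z - w) = coupling z + coupling w - pairing z w"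
  by (simp add: coupling_def pairing_def blinfun.diff_left blinfun.diff_right)

text \<open>Expanding \<open>coupling (z - w)\<close> turns monotonicity into the inequality that
  defines a polar, for points lifted to height \<open>coupling\<close>.\<close>

lemma monotone_set_iff:
  "monotone_set M \<longleftrightarrow> (\<forall>z\<in>M. \<forall>w\<in>M. pairing z w \<le> coupling z + coupling w)"
proof -
  have "blinfun_apply (p - q) (x - y) = coupling (x, p) + coupling (y, q) - pairing (x, p) (y, q)"
    for x y :: 'a and p q :: "'a dual"
    using coupling_diff[of "(x, p)" "(y, q)"] by (simp add: coupling_def)
  then show ?thesis
    by (simp add: monotone_set_def case_prod_beta)
qed

text \<open>Restricting \<open>f\<close> to the factors gives \<open>p\<close> in the dual and
  \<open>F\<close> in the bidual; reflexivity turns \<open>F\<close> into a point \<open>x\<close>.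
  For the norm, testing \<open>f\<close> at (y, q) with \<open>q\<close> norming \<open>x\<close>
  leaves a quadratic bound on \<open>p\<close>.\<close>

lemma reflexive_riesz:
  fixes f :: "('a::real_normed_vector \<times> 'a dual) dual"
  assumes "reflexive_space TYPE('a)"
  obtains v where "\<And>z. f z = pairing v z" "norm v \<le> norm f"
proof -
  define p :: "'a dual" where "p = Blinfun (\<lambda>y. f (y, 0))"
  define F :: "'a dual dual" where "F = Blinfun (\<lambda>q. f (0, q))"
  have p: "p y = f (y, 0)" for y
    unfolding p_def
    by (subst bounded_linear_Blinfun_apply)
      (auto intro!: bounded_linear_compose[OF blinfun.bounded_linear_right]
        bounded_linear_Pair bounded_linear_ident bounded_linear_zero)
  have F: "F q = f (0, q)" for q
    unfolding F_def
    by (subst bounded_linear_Blinfun_apply)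
      (auto intro!: bounded_linear_compose[OF blinfun.bounded_linear_right]
        bounded_linear_Pair bounded_linear_ident bounded_linear_zero)
  obtain x where x: "F = bidual_embedding x"
    using assms unfolding reflexive_space_def by blast
  have f: "f z = pairing (x, p) z" for z
  proof -
    have "f z = f (fst z, 0) + f (0, snd z)"
      by (simp flip: blinfun.add_right)
    also have "f (0, snd z) = blinfun_apply (snd z) x"
      using F[of "snd z"] x by simp
    finally show ?thesis
      by (simp add: pairing_def p)
  qed
  obtain q :: "'a dual" where q: "(norm q)\<^sup>2 / 2 + (norm x)\<^sup>2 / 2 \<le> q x"
    by (rule dual_norming)
  have "p y - (norm y)\<^sup>2 / 2 \<le> (norm f)\<^sup>2 / 2 - (norm x)\<^sup>2 / 2" for y
  proof -
    have "f (y, q) \<le> norm f * norm (y, q)"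
      using norm_blinfun[of f "(y, q)"] by simp
    moreover have "0 \<le> (norm f - norm (y, q))\<^sup>2"
      by simp
    ultimately have "f (y, q) \<le> (norm f)\<^sup>2 / 2 + (norm (y, q))\<^sup>2 / 2"
      by (simp add: power2_eq_square algebra_simps)
    then show ?thesis
      using q by (simp add: f pairing_def norm_prod_power2 add_divide_distrib)
  qed
  then have "(norm p)\<^sup>2 / 2 \<le> (norm f)\<^sup>2 / 2 - (norm x)\<^sup>2 / 2"
    using norm_le_of_quadratic_bound(2)[of "blinfun_apply p" "(norm f)\<^sup>2 / 2 - (norm x)\<^sup>2 / 2"]
    by (simp add: bounded_linear.linear[OF blinfun.bounded_linear_right] blinfun_apply_inverse)
  then have "(norm (x, p))\<^sup>2 \<le> (norm f)\<^sup>2"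
    by (simp add: norm_prod_power2)
  then have "norm (x, p) \<le> norm f"
    by (rule power2_le_imp_le) simp
  with f that show thesis by blast
qed

lemma pairing_duality:
  fixes C :: "(('a::real_normed_vector \<times> 'a dual) \<times> real) set"
  assumes "reflexive_space TYPE('a)" "convex C" "C \<noteq> {}"
    and "\<And>y r. (y, r) \<in> C \<Longrightarrow> 0 \<le> (norm y)\<^sup>2 / 2 + r"
  obtains v where "\<And>y r. (y, r) \<in> C \<Longrightarrow> (norm v)\<^sup>2 / 2 \<le> pairing v y + r"
proof -
  obtain f :: "('a \<times> 'a dual) dual" where
    f: "\<And>y r. (y, r) \<in> C \<Longrightarrow> (norm f)\<^sup>2 / 2 \<le> f y + r"
    using quadratic_duality[OF assms(2-4)] by blast
  obtain v where v: "\<And>z. f z = pairing v z" "norm v \<le> norm f"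
    using reflexive_riesz[OF assms(1)] by blast
  have "(norm v)\<^sup>2 \<le> (norm f)\<^sup>2"
    using v(2) by (rule power_mono) simp
  then have "(norm v)\<^sup>2 / 2 \<le> pairing v y + r" if "(y, r) \<in> C" for y r
    using f[OF that] unfolding v(1) by linarith
  with that show thesis by blast
qed

section \<open>Polar sets of epigraphs\<close>

text \<open>The polar of the epigraph of a function is the epigraph of its Legendre transform.\<close>

definition polar :: "(('a::real_normed_vector \<times> 'a dual) \<times> real) set \<Rightarrow> (('a \<times> 'a dual) \<times> real) set"
  where "polar E = {(z, a). \<forall>(y, r)\<in>E. pairing z y \<le> a + r}"

definition epigraph :: "('b \<Rightarrow> ereal) \<Rightarrow> ('b \<times> real) set" where
  "epigraph f = {(z, a). f z \<le> ereal a}"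

lemma polarI: "(\<And>y r. (y, r) \<in> E \<Longrightarrow> pairing z y \<le> a + r) \<Longrightarrow> (z, a) \<in> polar E"
  by (auto simp: polar_def)

lemma polarD: "(z, a) \<in> polar E \<Longrightarrow> (y, r) \<in> E \<Longrightarrow> pairing z y \<le> a + r"
  by (auto simp: polar_def)

lemma polar_antimono: "E \<subseteq> E' \<Longrightarrow> polar E' \<subseteq> polar E"
  by (auto simp: polar_def)

lemma subset_polar_polar: "E \<subseteq> polar (polar E)"
proof
  fix e assume "e \<in> E"
  then show "e \<in> polar (polar E)"
    by (cases e) (auto intro!: polarI dest: polarD simp: pairing_commute add.commute)
qed

lemma polar_polar_polar: "polar (polar (polar E)) = polar E"
  using polar_antimono[OF subset_polar_polar[of E]] subset_polar_polar[of "polar E"] by blast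

lemma polar_convex_comb:
  assumes "(z, a) \<in> polar E" "(w, b) \<in> polar E" "0 \<le> u" "0 \<le> v" "u + v = 1"
  shows "(u *\<^sub>R z + v *\<^sub>R w, u * a + v * b) \<in> polar E"
proof (rule polarI)
  fix y r assume yr: "(y, r) \<in> E"
  have "u * pairing z y + v * pairing w y \<le> u * (a + r) + v * (b + r)"
    using assms yr by (intro add_mono mult_left_mono) (auto dest: polarD)
  also have "\<dots> = u * a + v * b + (u + v) * r"
    by (simp add: algebra_simps)
  finally show "pairing (u *\<^sub>R z + v *\<^sub>R w) y \<le> u * a + v * b + r"
    using assms(5) by (simp add: pairing_simps)
qed

text \<open>Pairing the point with itself gives 2 \<open>coupling z\<close> \<le> 2 a. Height
  \<open>coupling z\<close> is thus the lowest possible, and the derived field collects the points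
  where it is reached.\<close>

lemma self_polar_coupling_le:
  assumes "polar P = P" "(z, a) \<in> P"
  shows "coupling z \<le> a"
  using polarD[of z a P z a] assms by (simp add: pairing_self)

lemma self_polar_nonempty:
  assumes "polar P = P"
  shows "P \<noteq> {}"
  using assms by (auto simp: polar_def)

lemma self_polar_monotone:
  assumes "polar P = P"
  shows "monotone_set {z. (z, coupling z) \<in> P}"
  unfolding monotone_set_iff using assms by (auto intro: polarD)

lemma self_polar_maximal:
  fixes P :: "(('a::real_normed_vector \<times> 'a dual) \<times> real) set"
  assumes reflexive: "reflexive_space TYPE('a)" and P: "polar P = P"
    and related: "\<And>z. (z, coupling z) \<in> P \<Longrightarrow> pairing z\<^sub>0 z \<le> coupling z\<^sub>0 + coupling z"
  shows "(z\<^sub>0, coupling z\<^sub>0) \<in> P"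
proof -
  \<comment> \<open>The epigraph of \<open>y \<mapsto> L (z\<^sub>0 + y) - \<langle>z\<^sub>0, y\<rangle> - coupling z\<^sub>0\<close>, which is again self-polar.\<close>
  define C where "C = {(y, r). (z\<^sub>0 + y, r + pairing z\<^sub>0 y + coupling z\<^sub>0) \<in> P}"
  have "convex C"
  proof (rule convexI)
    fix e e' :: "('a \<times> 'a dual) \<times> real" and u v :: real
    assume e: "e \<in> C" "e' \<in> C" and uv: "0 \<le> u" "0 \<le> v" "u + v = 1"
    obtain y r y' r' where [simp]: "e = (y, r)" "e' = (y', r')" by (metis surj_pair)
    have "(u *\<^sub>R (z\<^sub>0 + y) + v *\<^sub>R (z\<^sub>0 + y'),
        u * (r + pairing z\<^sub>0 y + coupling z\<^sub>0) + v * (r' + pairing z\<^sub>0 y' + coupling z\<^sub>0)) \<in> polar P"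
      using e uv by (intro polar_convex_comb) (auto simp: C_def P)
    moreover have "u *\<^sub>R (z\<^sub>0 + y) + v *\<^sub>R (z\<^sub>0 + y') = (u + v) *\<^sub>R z\<^sub>0 + (u *\<^sub>R y + v *\<^sub>R y')"
      by (simp add: algebra_simps)
    moreover have "u * (r + pairing z\<^sub>0 y + coupling z\<^sub>0) + v * (r' + pairing z\<^sub>0 y' + coupling z\<^sub>0)
      = u * r + v * r' + pairing z\<^sub>0 (u *\<^sub>R y + v *\<^sub>R y') + (u + v) * coupling z\<^sub>0"
      by (simp add: pairing_simps algebra_simps)
    ultimately show "u *\<^sub>R e + v *\<^sub>R e' \<in> C"
      using uv(3) P by (simp add: C_def)
  qed
  moreover have shift: "(y - z\<^sub>0, r - pairing z\<^sub>0 (y - z\<^sub>0) - coupling z\<^sub>0) \<in> C" if "(y, r) \<in> P" for y r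
    using that by (simp add: C_def)
  then have "C \<noteq> {}"
    using self_polar_nonempty[OF P] by fastforce
  \<comment> \<open>The bound by \<open>coupling\<close> survives recentring as
    \<open>coupling y\<close> \<le> r.\<close>
  moreover have "0 \<le> (norm y)\<^sup>2 / 2 + r" if "(y, r) \<in> C" for y r
  proof -
    have "coupling (z\<^sub>0 + y) \<le> r + pairing z\<^sub>0 y + coupling z\<^sub>0"
      using that by (intro self_polar_coupling_le[OF P]) (simp add: C_def)
    moreover have "coupling (z\<^sub>0 + y) = coupling z\<^sub>0 + coupling y + pairing z\<^sub>0 y"
      by (simp add: coupling_def pairing_def blinfun.add_left blinfun.add_right)
    moreover have "\<bar>coupling y\<bar> \<le> (norm y)\<^sup>2 / 2"
      using abs_pairing_le_squares[of y y] by (simp add: pairing_self)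
    ultimately show ?thesis by simp
  qed
  ultimately obtain v where v: "\<And>y r. (y, r) \<in> C \<Longrightarrow> (norm v)\<^sup>2 / 2 \<le> pairing v y + r"
    using pairing_duality[OF reflexive] by blast
  \<comment> \<open>With this \<open>k\<close>, the duality inequality says precisely that (w, k)
    lies in the polar of \<open>P\<close>, that is, in \<open>P\<close>. Then
    \<open>coupling w\<close> \<le> k becomes an upper bound on \<open>coupling v\<close>.\<close>
  define w where "w = z\<^sub>0 - v"
  define k where "k = coupling w - coupling v - (norm v)\<^sup>2 / 2"
  have "(w, k) \<in> polar P"
  proof (rule polarI)
    fix y r assume "(y, r) \<in> P"
    from v[OF shift[OF this]] show "pairing w y \<le> k + r"
      unfolding k_def w_def coupling_diff
      by (simp add: pairing_simps pairing_self pairing_commute[of z\<^sub>0 v])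
  qed
  then have wk: "(w, k) \<in> P" and "coupling w \<le> k"
    using P self_polar_coupling_le[OF P] by auto
  then have v0: "coupling v + (norm v)\<^sup>2 / 2 \<le> 0"
    by (simp add: k_def)
  moreover have "0 \<le> coupling v + (norm v)\<^sup>2 / 2"
    using abs_pairing_le_squares[of v v] by (simp add: pairing_self)
  \<comment> \<open>Both bounds together put \<open>w\<close> at its lowest height, so
    \<open>related\<close> applies to it.\<close>
  ultimately have "k = coupling w"
    unfolding k_def by linarith
  then have "(w, coupling w) \<in> P"
    using wk by simp
  moreover from related[OF this] have "0 \<le> coupling v"
    using coupling_diff[of z\<^sub>0 w] by (simp add: w_def)
  then have "v = 0"
    using v0 by (smt (verit) field_sum_of_halves zero_le_power2 zero_eq_power2 norm_eq_zero)
  ultimately show ?thesis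
    by (simp add: w_def)
qed

section \<open>Selfdual Lagrangians and self-polar sets\<close>

lemma legendre_pairing: "legendre L (p, x) = (SUP w. ereal (pairing (x, p) w) - L w)"
  by (simp add: legendre_def pairing_def case_prod_beta)

lemma legendre_le_iff: "legendre L (p, x) \<le> ereal a \<longleftrightarrow> ((x, p), a) \<in> polar (epigraph L)"
proof -
  \<comment> \<open>Each term of the supremum is compared with all real heights above
    \<open>L w\<close>. For \<open>L w\<close> = \<infinity> both sides hold trivially; for
    -\<infinity> both fail.\<close>
  have "ereal b - L w \<le> ereal a \<longleftrightarrow> (\<forall>r. L w \<le> ereal r \<longrightarrow> b \<le> a + r)" for b w
  proof (cases "L w")
    case (real s)
    then show ?thesis by (auto intro: order_trans)
  next
    case PInf
    then show ?thesis by simp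
  next
    case MInf
    have "\<exists>r. \<not> b \<le> a + r" by (intro exI[of _ "b - a - 1"]) simp
    then show ?thesis using MInf by simp
  qed
  then show ?thesis
    by (auto simp: legendre_pairing SUP_le_iff polar_def epigraph_def)
qed

lemma ereal_eqI_real:
  fixes x y :: ereal
  assumes "\<And>a. x \<le> ereal a \<longleftrightarrow> y \<le> ereal a"
  shows "x = y"
  using assms ereal_le_real[of x y] ereal_le_real[of y x] by (auto intro: order_antisym)

lemma legendre_selfdual_iff:
  "(\<forall>p x. legendre L (p, x) = L (x, p)) \<longleftrightarrow> polar (epigraph L) = epigraph L"
proof
  assume *: "\<forall>p x. legendre L (p, x) = L (x, p)"
  show "polar (epigraph L) = epigraph L"
    using * legendre_le_iff[of L] by (auto simp: epigraph_def)
next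
  assume "polar (epigraph L) = epigraph L"
  then show "\<forall>p x. legendre L (p, x) = L (x, p)"
    using legendre_le_iff[of L] by (auto simp: epigraph_def intro!: ereal_eqI_real)
qed

text \<open>Self-polarity gives \<open>coupling\<close> \<le> \<open>L\<close>, so the equation
  defining the derived field reduces to one inequality.\<close>

lemma op_graph_derived_field:
  assumes "polar (epigraph L) = epigraph L"
  shows "op_graph (derived_field L) = {z. (z, coupling z) \<in> epigraph L}"
proof -
  have "L z - ereal (coupling z) = 0 \<longleftrightarrow> L z \<le> ereal (coupling z)" for z
  proof -
    have "coupling z \<le> a" if "L z \<le> ereal a" for a
      using self_polar_coupling_le[OF assms, of z a] that by (simp add: epigraph_def)
    then have "ereal (coupling z) \<le> L z"
      using ereal_le_real[of "L z" "ereal (coupling z)"] by auto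
    then show ?thesis by (cases "L z") auto
  qed
  then show ?thesis
    by (auto simp: op_graph_def derived_field_def epigraph_def coupling_def)
qed

text \<open>The supremum \<open>N\<close> of the continuous affine functions indexed by
  \<open>P\<close> has the polar of \<open>P\<close> as its epigraph, which is \<open>P\<close>
  again. Convexity and lower semicontinuity are inherited from the affine functions.\<close>

lemma selfdual_lagrangian_of_self_polar:
  assumes P: "polar P = P"
  obtains N where "selfdual_lagrangian N" "epigraph N = P"
proof -
  define N where "N z = (SUP (y, r)\<in>P. ereal (pairing z y - r))" for z
  have N_le: "N z \<le> e \<longleftrightarrow> (\<forall>(y, r)\<in>P. ereal (pairing z y - r) \<le> e)" for z e
    by (auto simp: N_def SUP_le_iff)
  have N_ge: "ereal (pairing z y - r) \<le> N z" if "(y, r) \<in> P" for z y r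
    using N_le[of z "N z"] that by auto
  have epi: "epigraph N = P"
  proof -
    have "epigraph N = polar P"
      by (auto simp: epigraph_def polar_def N_le algebra_simps)
    with P show ?thesis by simp
  qed
  have finite_below: "N z \<noteq> - \<infinity>" for z
  proof -
    obtain y r where "(y, r) \<in> P"
      using self_polar_nonempty[OF P] by auto
    from N_ge[OF this, of z] show ?thesis by auto
  qed
  have "convex_fun N"
    unfolding convex_fun_def
  proof (intro allI impI)
    fix z w and u v :: real
    assume uv: "u \<ge> 0" "v \<ge> 0" "u + v = 1"
    have "ereal (pairing (u *\<^sub>R z + v *\<^sub>R w) y - r) \<le> ereal u * N z + ereal v * N w"
      if yr: "(y, r) \<in> P" for y r
    proof -
      have "pairing (u *\<^sub>R z + v *\<^sub>R w) y - r = u * pairing z y + v * pairing w y - (u + v) * r"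
        using uv by (simp add: pairing_simps)
      also have "\<dots> = u * (pairing z y - r) + v * (pairing w y - r)"
        by (simp add: algebra_simps)
      finally have "ereal (pairing (u *\<^sub>R z + v *\<^sub>R w) y - r)
        = ereal u * ereal (pairing z y - r) + ereal v * ereal (pairing w y - r)"
        by simp
      also have "\<dots> \<le> ereal u * N z + ereal v * N w"
        using uv yr by (intro add_mono ereal_mult_left_mono N_ge) auto
      finally show ?thesis .
    qed
    then show "N (u *\<^sub>R z + v *\<^sub>R w) \<le> ereal u * N z + ereal v * N w"
      by (auto simp: N_le)
  qed
  moreover have "lower_semicontinuous N"
    unfolding lower_semicontinuous_def le_Liminf_iff
  proof (intro allI impI)
    fix z b assume "b < N z"
    then obtain y r where yr: "(y, r) \<in> P" "b < ereal (pairing z y - r)"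
      by (auto simp: N_def less_SUP_iff)
    have "((\<lambda>w. ereal (pairing w y - r)) \<longlongrightarrow> ereal (pairing z y - r)) (at z)"
      by (intro tendsto_ereal tendsto_diff pairing.tendsto tendsto_ident_at tendsto_const)
    then have "\<forall>\<^sub>F w in at z. b < ereal (pairing w y - r)"
      using yr(2) by (rule order_tendstoD)
    then show "\<forall>\<^sub>F w in at z. b < N w"
      by (rule eventually_mono) (use N_ge[OF yr(1)] in \<open>auto intro: less_le_trans\<close>)
  qed
  ultimately have "selfdual_lagrangian N"
    using finite_below legendre_selfdual_iff[of N] P epi by (simp add: selfdual_lagrangian_def)
  with epi that show thesis by blast
qed

theorem maximal_monotone_derived_field:
  fixes L :: "'a::real_normed_vector \<times> 'a dual \<Rightarrow> ereal"
  assumes reflexive: "reflexive_space TYPE('a)" and L: "selfdual_lagrangian L"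
  shows "maximal_monotone (derived_field L)"
proof -
  have P: "polar (epigraph L) = epigraph L"
    using L legendre_selfdual_iff[of L] by (simp add: selfdual_lagrangian_def)
  have "M = op_graph (derived_field L)"
    if M: "monotone_set M" "op_graph (derived_field L) \<subseteq> M" for M
  proof
    show "M \<subseteq> op_graph (derived_field L)"
    proof
      fix z assume "z \<in> M"
      with M show "z \<in> op_graph (derived_field L)"
        unfolding op_graph_derived_field[OF P] monotone_set_iff
        by (auto intro!: self_polar_maximal[OF reflexive P])
    qed
  qed (rule M(2))
  then show ?thesis
    using self_polar_monotone[OF P] op_graph_derived_field[OF P]
    by (simp add: maximal_monotone_def)
qed

section \<open>The self-polar average\<close>

text \<open>Here z = (a + b) / 2 and u = (a - b) / 2. Only heights of actual decompositions are
  collected, so equality with the polar also says that the infimum over u is attained.\<close>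

definition proximal_average ::
  "(('a::real_normed_vector \<times> 'a dual) \<times> real) set \<Rightarrow> (('a \<times> 'a dual) \<times> real) set \<Rightarrow>
    (('a \<times> 'a dual) \<times> real) set" where
  "proximal_average E E' =
    {((a + b) /\<^sub>R 2, (s + t) / 2 + (norm ((a - b) /\<^sub>R 2))\<^sup>2 / 2) |a b s t. (a, s) \<in> E \<and> (b, t) \<in> E'}"

text \<open>The pairing of two midpoints is the pairing of the half differences plus cross terms.
  Polarity of the two sets bounds the cross terms, and the squares bound the rest.\<close>

lemma proximal_average_subset_polar:
  "proximal_average E (polar E) \<subseteq> polar (proximal_average E (polar E))"
proof -
  have "pairing ((a + b) /\<^sub>R 2) ((a' + b') /\<^sub>R 2)
      \<le> (s + t) / 2 + (norm ((a - b) /\<^sub>R 2))\<^sup>2 / 2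
        + ((s' + t') / 2 + (norm ((a' - b') /\<^sub>R 2))\<^sup>2 / 2)"
    if "(a, s) \<in> E" "(b, t) \<in> polar E" "(a', s') \<in> E" "(b', t') \<in> polar E" for a b a' b' s t s' t'
  proof -
    have "pairing ((a + b) /\<^sub>R 2) ((a' + b') /\<^sub>R 2)
      = pairing ((a - b) /\<^sub>R 2) ((a' - b') /\<^sub>R 2) + (pairing b' a + pairing b a') / 2"
      by (simp add: pairing_simps pairing_commute[of b'] field_simps)
    moreover have "pairing b' a \<le> t' + s" "pairing b a' \<le> t + s'"
      using that by (auto dest: polarD)
    moreover have "pairing ((a - b) /\<^sub>R 2) ((a' - b') /\<^sub>R 2)
        \<le> (norm ((a - b) /\<^sub>R 2))\<^sup>2 / 2 + (norm ((a' - b') /\<^sub>R 2))\<^sup>2 / 2"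
      by (rule order_trans[OF abs_ge_self abs_pairing_le_squares])
    ultimately show ?thesis
      by (simp add: add_divide_distrib)
  qed
  then show ?thesis
    by (auto simp: proximal_average_def intro!: polarI)
qed

lemma polar_proximal_average:
  fixes E :: "(('a::real_normed_vector \<times> 'a dual) \<times> real) set"
  assumes reflexive: "reflexive_space TYPE('a)"
    and E: "polar (polar E) = E" "E \<noteq> {}" "polar E \<noteq> {}"
    and wk: "(w, k) \<in> polar (proximal_average E (polar E))"
  shows "(w, k) \<in> proximal_average E (polar E)"
proof -
  \<comment> \<open>The product of \<open>E\<close> and its polar, pushed forward to half
    differences. The heights make the nonnegativity required by duality the same as polarity of (w,
    k).\<close>
  define C where "C = {((a - b) /\<^sub>R 2, (s + t) / 2 - pairing w ((a + b) /\<^sub>R 2) + k) |a b s t.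
    (a, s) \<in> E \<and> (b, t) \<in> polar E}"
  have CI: "((a - b) /\<^sub>R 2, (s + t) / 2 - pairing w ((a + b) /\<^sub>R 2) + k) \<in> C"
    if "(a, s) \<in> E" "(b, t) \<in> polar E" for a b s t
    using that unfolding C_def by blast
  have "convex C"
  proof (rule convexI)
    fix e e' :: "('a \<times> 'a dual) \<times> real" and u v :: real
    assume e: "e \<in> C" "e' \<in> C" and uv: "0 \<le> u" "0 \<le> v" "u + v = 1"
    obtain a b s t where ab: "(a, s) \<in> E" "(b, t) \<in> polar E"
      "e = ((a - b) /\<^sub>R 2, (s + t) / 2 - pairing w ((a + b) /\<^sub>R 2) + k)"
      using e(1) unfolding C_def by blast
    obtain a' b' s' t' where ab': "(a', s') \<in> E" "(b', t') \<in> polar E"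
      "e' = ((a' - b') /\<^sub>R 2, (s' + t') / 2 - pairing w ((a' + b') /\<^sub>R 2) + k)"
      using e(2) unfolding C_def by blast
    have "(u *\<^sub>R a + v *\<^sub>R a', u * s + v * s') \<in> E"
      using polar_convex_comb[of a s "polar E" a' s' u v] ab ab' uv E(1) by simp
    moreover have "(u *\<^sub>R b + v *\<^sub>R b', u * t + v * t') \<in> polar E"
      using polar_convex_comb ab ab' uv by blast
    moreover have "u *\<^sub>R e + v *\<^sub>R e' =
      (((u *\<^sub>R a + v *\<^sub>R a') - (u *\<^sub>R b + v *\<^sub>R b')) /\<^sub>R 2,
       ((u * s + v * s') + (u * t + v * t')) / 2
         - pairing w (((u *\<^sub>R a + v *\<^sub>R a') + (u *\<^sub>R b + v *\<^sub>R b')) /\<^sub>R 2) + (u + v) * k)"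
      unfolding ab ab' by (simp add: pairing_simps algebra_simps add_divide_distrib)
    ultimately show "u *\<^sub>R e + v *\<^sub>R e' \<in> C"
      using CI uv(3) by simp
  qed
  moreover have "C \<noteq> {}"
    using E CI by fastforce
  moreover have "0 \<le> (norm y)\<^sup>2 / 2 + r" if yr: "(y, r) \<in> C" for y r
  proof -
    obtain a b s t where ab: "(a, s) \<in> E" "(b, t) \<in> polar E"
      "y = (a - b) /\<^sub>R 2" "r = (s + t) / 2 - pairing w ((a + b) /\<^sub>R 2) + k"
      using yr unfolding C_def by blast
    then have "((a + b) /\<^sub>R 2, (s + t) / 2 + (norm y)\<^sup>2 / 2) \<in> proximal_average E (polar E)"
      unfolding proximal_average_def by blast
    from polarD[OF wk this] ab(4) show ?thesis by simp
  qed
  ultimately obtain v where v: "\<And>y r. (y, r) \<in> C \<Longrightarrow> (norm v)\<^sup>2 / 2 \<le> pairing v y + r"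
    using pairing_duality[OF reflexive] by blast
  \<comment> \<open>The duality inequality separates into a part for \<open>E\<close> and a part for
    its polar. With \<open>E\<close> the epigraph of F, \<open>\<beta>\<close> is the conjugate of F
    at \<open>w - v\<close>, and \<open>\<alpha>\<close> is the remainder, which bounds the
    biconjugate at \<open>w + v\<close>. The dual solution \<open>v\<close> thus provides the
    decomposition of \<open>w\<close>.\<close>
  have bound: "(pairing (w - v) a - s) + (pairing (w + v) b - t) \<le> 2 * (k - (norm v)\<^sup>2 / 2)"
    if "(a, s) \<in> E" "(b, t) \<in> polar E" for a b s t
    using v[OF CI[OF that]] by (simp add: pairing_simps field_simps)
  define \<beta> where "\<beta> = (SUP (a, s)\<in>E. pairing (w - v) a - s)"
  define \<alpha> where "\<alpha> = 2 * (k - (norm v)\<^sup>2 / 2) - \<beta>"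
  obtain b\<^sub>0 t\<^sub>0 where bt: "(b\<^sub>0, t\<^sub>0) \<in> polar E" using E(3) by auto
  have bdd: "bdd_above ((\<lambda>(a, s). pairing (w - v) a - s) ` E)"
    using bound[OF _ bt] by (intro bdd_aboveI[of _ "2 * (k - (norm v)\<^sup>2 / 2) - (pairing (w + v) b\<^sub>0 - t\<^sub>0)"])
      (auto simp: algebra_simps)
  have "(w - v, \<beta>) \<in> polar E"
  proof (rule polarI)
    fix a s assume "(a, s) \<in> E"
    from cSUP_upper[OF this bdd] show "pairing (w - v) a \<le> \<beta> + s"
      by (simp add: \<beta>_def)
  qed
  moreover have "(w + v, \<alpha>) \<in> polar (polar E)"
  proof (rule polarI)
    fix b t assume "(b, t) \<in> polar E"
    then have "\<beta> \<le> 2 * (k - (norm v)\<^sup>2 / 2) - (pairing (w + v) b - t)"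
      unfolding \<beta>_def using bound E(2) by (intro cSUP_least) fastforce+
    then show "pairing (w + v) b \<le> \<alpha> + t"
      by (simp add: \<alpha>_def)
  qed
  ultimately have "(((w + v) + (w - v)) /\<^sub>R 2, (\<alpha> + \<beta>) / 2 + (norm (((w + v) - (w - v)) /\<^sub>R 2))\<^sup>2 / 2)
    \<in> proximal_average E (polar E)"
    unfolding proximal_average_def using E(1) by blast
  moreover have "((w + v) + (w - v)) /\<^sub>R 2 = w" "((w + v) - (w - v)) /\<^sub>R 2 = v"
    by (simp_all flip: scaleR_2)
  moreover have "(\<alpha> + \<beta>) / 2 + (norm v)\<^sup>2 / 2 = k"
    by (simp add: \<alpha>_def field_simps)
  ultimately show ?thesis
    by simp
qed

lemma self_polar_proximal_average:
  fixes E :: "(('a::real_normed_vector \<times> 'a dual) \<times> real) set"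
  assumes "reflexive_space TYPE('a)" "polar (polar E) = E" "E \<noteq> {}" "polar E \<noteq> {}"
  shows "polar (proximal_average E (polar E)) = proximal_average E (polar E)"
  using polar_proximal_average[OF assms] proximal_average_subset_polar[of E] by auto

theorem maximal_monotone_is_derived_field:
  fixes T :: "'a::real_normed_vector \<Rightarrow> 'a dual set"
  assumes reflexive: "reflexive_space TYPE('a)" and T: "maximal_monotone T" and dom: "op_domain T \<noteq> {}"
  obtains N where "selfdual_lagrangian N" "\<And>x. T x = derived_field N x"
proof -
  define H where "H = (\<lambda>z. (z, coupling z)) ` op_graph T"
  \<comment> \<open>The epigraph of the Fitzpatrick function of \<open>T\<close>.\<close>
  define E where "E = polar H"
  have mono: "monotone_set (op_graph T)"
    and max: "\<And>M. monotone_set M \<Longrightarrow> op_graph T \<subseteq> M \<Longrightarrow> M = op_graph T"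
    using T by (auto simp: maximal_monotone_def)
  \<comment> \<open>Monotonicity places \<open>H\<close> inside its own polar. The inclusion in the
    bipolar is general, so the nonempty \<open>H\<close> lies in both sets to be averaged.\<close>
  have "H \<subseteq> E"
    using mono unfolding H_def E_def monotone_set_iff by (auto intro!: polarI)
  moreover have "H \<subseteq> polar E"
    unfolding E_def by (rule subset_polar_polar)
  moreover have "H \<noteq> {}"
    using dom by (auto simp: H_def op_graph_def op_domain_def)
  moreover have "polar (polar E) = E"
    unfolding E_def by (rule polar_polar_polar)
  ultimately have P: "polar (proximal_average E (polar E)) = proximal_average E (polar E)"
    by (intro self_polar_proximal_average[OF reflexive]) auto
  obtain N where N: "selfdual_lagrangian N" "epigraph N = proximal_average E (polar E)"
    using selfdual_lagrangian_of_self_polar[OF P] by blast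
  have graph: "op_graph (derived_field N) = {z. (z, coupling z) \<in> proximal_average E (polar E)}"
    using op_graph_derived_field[of N] N(2) P by simp
  have "op_graph T \<subseteq> op_graph (derived_field N)"
  proof
    fix z assume "z \<in> op_graph T"
    then have "(z, coupling z) \<in> E" "(z, coupling z) \<in> polar E"
      using \<open>H \<subseteq> E\<close> \<open>H \<subseteq> polar E\<close> by (auto simp: H_def)
    \<comment> \<open>The trivial decomposition a = b = z adds no quadratic cost and keeps the
      height \<open>coupling z\<close>.\<close>
    then have "((z + z) /\<^sub>R 2, (coupling z + coupling z) / 2 + (norm ((z - z) /\<^sub>R 2))\<^sup>2 / 2)
        \<in> proximal_average E (polar E)"
      unfolding proximal_average_def by blast
    then show "z \<in> op_graph (derived_field N)"
      by (simp add: graph flip: scaleR_2)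
  qed
  then have "op_graph (derived_field N) = op_graph T"
    using max self_polar_monotone[OF P] graph by simp
  then have "T x = derived_field N x" for x
    by (auto simp: op_graph_def set_eq_iff)
  with N(1) that show thesis by blast
qed

theorem theorem1p1:
  assumes reflexive: "reflexive_space TYPE('a::banach)"
  shows "(\<forall>L :: 'a \<times> 'a dual \<Rightarrow> ereal.
            selfdual_lagrangian L \<and> proper_fun L \<longrightarrow> maximal_monotone (derived_field L)) \<and>
         (\<forall>T :: 'a \<Rightarrow> 'a dual set.
            maximal_monotone T \<and> op_domain T \<noteq> {} \<longrightarrow>
            (\<exists>N :: 'a \<times> 'a dual \<Rightarrow> ereal. selfdual_lagrangian N \<and> (\<forall>x. T x = derived_field N x)))"
  using maximal_monotone_derived_field[OF reflexive] maximal_monotone_is_derived_field[OF reflexive]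
  by metis

end
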